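(* Let $\mathbb{F}$ be a field of characteristic zero. For every derivation $d$ of the Lie algebra $W_\infty(\mathbb{F})$ there exists an element $a \in W_{\mathrm{fin}}(\mathbb{F})$ such that $d$ is the restriction to $W_\infty(\mathbb{F})$ of the adjoint operator $\mathrm{ad}(a): x \mapsto [x,a]$, i.e. $d(x)=[x,a]$ for all $x\in W_\infty(\mathbb{F})$.
   Context: Let $X=\{x_1,x_2,\dots\}$ be a countably infinite set of variables, $X_n=\{x_1,\dots,x_n\}$, and $\mathbb{F}[X]$ the (commutative) polynomial algebra. $W_X(\mathbb{F})=\mathrm{Der}\,\mathbb{F}[X]$ is the Lie algebra (under commutator) of all $\mathbb{F}$-linear derivations of $\mathbb{F}[X]$; its elements are exactly the (possibly infinite) sums $\sum_{i=1}^\infty f_i\frac{\partial}{\partial x_i}$ with $f_i\in\mathbb{F}[X]$. $W_n(\mathbb{F})=\mathrm{Der}\,\mathbb{F}[X_n]=\{\sum_{i=1}^n f_i\frac{\partial}{\partial x_i} : f_i\in\mathbb{F}[X_n]\}$, viewed inside $W_X(\mathbb{F})$, and $W_\infty(\mathbb{F})=\bigcup_{n\ge1}W_n(\mathbb{F})$ (finite sums $\sum f_i\frac{\partial}{\partial x_i}$ with polynomial coefficients). $W_{\mathrm{fin}}(\mathbb{F})$ is the Lie subalgebra of $W_X(\mathbb{F})$ consisting of all $\sum_{i=1}^\infty f_i\frac{\partial}{\partial x_i}$, $f_i \in \mathbb{F}[X]$, such that each variable $x_n\in X$ occurs in only finitely many of the polynomials $f_i$, $i\ge1$. $W_\infty(\mathbb{F})$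 is an ideal of $W_{\mathrm{fin}}(\mathbb{F})$. A derivation of a Lie algebra $L$ is an $\mathbb{F}$-linear map $d:L\to L$ with $d([x,y])=[d(x),y]+[x,d(y)]$. *)

theory Defs
  imports Complex_Main "HOL-Library.Poly_Mapping"
begin

text \<open>
  A monomial is a finitely supported exponent function on \<^typ>\<open>nat\<close>; the polynomial algebra in
  countably many variables is the monoid algebra of the monomials, whose commutative ring
  structure is provided by \<^theory>\<open>HOL-Library.Poly_Mapping\<close>.
  The variables are numbered from 0, so the variable with index \<open>i\<close> is $x_{i+1}$.
\<close>

type_synonym monomial = "nat \<Rightarrow>\<^sub>0 nat"
type_synonym 'a polyX = "monomial \<Rightarrow>\<^sub>0 'a"

definition Const :: "'a::comm_ring_1 \<Rightarrow> 'a polyX" where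
  "Const c = Poly_Mapping.single 0 c"

definition Var :: "nat \<Rightarrow> 'a::comm_ring_1 polyX" where
  "Var i = Poly_Mapping.single (Poly_Mapping.single i 1) 1"

definition vars :: "'a::comm_ring_1 polyX \<Rightarrow> nat set" where
  "vars p = (\<Union>m \<in> Poly_Mapping.keys p. Poly_Mapping.keys m)"

definition polyX_upto :: "nat \<Rightarrow> 'a::comm_ring_1 polyX set" where
  "polyX_upto n = {p. vars p \<subseteq> {..<n}}"

text \<open>
  Partial differentiation, term by term. A monomial not containing the variable contributes 0,
  so the truncated subtraction of exponents is harmless.
\<close>

definition pdiff :: "nat \<Rightarrow> 'a::comm_ring_1 polyX \<Rightarrow> 'a polyX" where
  "pdiff i p = (\<Sum>m \<in> Poly_Mapping.keys p.
     Poly_Mapping.single (m - Poly_Mapping.single i 1)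
       (of_nat (Poly_Mapping.lookup m i) * Poly_Mapping.lookup p m))"

text \<open>
  The formal sum $\sum_i f_i \partial/\partial x_i$ acting on polynomials. For a given \<open>p\<close> only
  finitely many partial derivatives are nonzero (lemma \<open>finite_pdiff_nonzero\<close> below),
  so \<^const>\<open>Sum_any\<close>, the sum over the nonzero terms, has its intended value.
\<close>

definition vfield :: "(nat \<Rightarrow> 'a::comm_ring_1 polyX) \<Rightarrow> 'a polyX \<Rightarrow> 'a polyX" where
  "vfield f p = Sum_any (\<lambda>i. f i * pdiff i p)"

definition bracket :: "('a::comm_ring_1 polyX \<Rightarrow> 'a polyX) \<Rightarrow> ('a polyX \<Rightarrow> 'a polyX)
    \<Rightarrow> 'a polyX \<Rightarrow> 'a polyX" where
  "bracket D E = (\<lambda>p. D (E p) - E (D p))"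

definition W_X :: "('a::field_char_0 polyX \<Rightarrow> 'a polyX) set" where
  "W_X = {D. (\<forall>p q. D (p + q) = D p + D q) \<and> (\<forall>c p. D (Const c * p) = Const c * D p) \<and>
             (\<forall>p q. D (p * q) = D p * q + p * D q)}"

definition W_n :: "nat \<Rightarrow> ('a::field_char_0 polyX \<Rightarrow> 'a polyX) set" where
  "W_n n = {D. \<exists>f. (\<forall>i<n. f i \<in> polyX_upto n) \<and> D = (\<lambda>p. \<Sum>i<n. f i * pdiff i p)}"

definition W_inf :: "('a::field_char_0 polyX \<Rightarrow> 'a polyX) set" where
  "W_inf = (\<Union>n\<in>{1..}. W_n n)"

definition W_fin :: "('a::field_char_0 polyX \<Rightarrow> 'a polyX) set" where
  "W_fin = {D \<in> W_X. \<exists>f. D = vfield f \<and> (\<forall>n. finite {i. n \<in> vars (f i)})}"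

text \<open>
  Derivations of a Lie algebra \<open>L\<close> of operators; the vector space operations on operators are
  pointwise. Values of \<open>d\<close> outside \<open>L\<close> are irrelevant.
\<close>

definition lie_derivation_on ::
  "('a::field_char_0 polyX \<Rightarrow> 'a polyX) set \<Rightarrow>
   (('a polyX \<Rightarrow> 'a polyX) \<Rightarrow> ('a polyX \<Rightarrow> 'a polyX)) \<Rightarrow> bool" where
  "lie_derivation_on L d \<longleftrightarrow>
     (\<forall>x\<in>L. d x \<in> L) \<and>
     (\<forall>x\<in>L. \<forall>y\<in>L. d (\<lambda>p. x p + y p) = (\<lambda>p. d x p + d y p)) \<and>
     (\<forall>c. \<forall>x\<in>L. d (\<lambda>p. Const c * x p) = (\<lambda>p. Const c * d x p)) \<and>
     (\<forall>x\<in>L. \<forall>y\<in>L. d (bracket x y) = (\<lambda>p. bracket (d x) y p + bracket x (d y) p))"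

text \<open>
  Consistency of the definitions: the derivations are exactly the formal sums
  (\<open>W_X_eq_range_vfield\<close>), \<open>W_inf \<subseteq> W_fin\<close>, and \<open>W_inf\<close> is closed under the bracket.
\<close>

lemma poly_sum_singles:
  fixes p :: "'k \<Rightarrow>\<^sub>0 'b::comm_monoid_add"
  shows "p = (\<Sum>m \<in> Poly_Mapping.keys p. Poly_Mapping.single m (Poly_Mapping.lookup p m))"
  by (rule poly_mapping_eqI)
     (auto simp: lookup_sum lookup_single when_def in_keys_iff)

lemma poly_mapping_single_add_induct [case_names single add]:
  fixes p :: "'k \<Rightarrow>\<^sub>0 'b::comm_monoid_add"
  assumes s: "\<And>m c. P (Poly_Mapping.single m c)"
    and a: "\<And>p q. P p \<Longrightarrow> P q \<Longrightarrow> P (p + q)"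
  shows "P p"
proof -
  have "P (\<Sum>m \<in> A. Poly_Mapping.single m (Poly_Mapping.lookup p m))" if "finite A" for A
    using that
  proof (induction A)
    case empty
    show ?case using s[of undefined 0] by simp
  next
    case (insert m A)
    then show ?case using s a by simp
  qed
  then show ?thesis using poly_sum_singles[of p] by (metis finite_keys)
qed

lemma pdiff_superset:
  assumes "finite A" "Poly_Mapping.keys p \<subseteq> A"
  shows "pdiff i p = (\<Sum>m \<in> A. Poly_Mapping.single (m - Poly_Mapping.single i 1)
           (of_nat (Poly_Mapping.lookup m i) * Poly_Mapping.lookup p m))"
  unfolding pdiff_def using assms
  by (intro sum.mono_neutral_left) (auto simp: in_keys_iff)

lemma pdiff_add: "pdiff i (p + q) = pdiff i p + pdiff i q"
proof -
  let ?A = "Poly_Mapping.keys p \<union> Poly_Mapping.keys q"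
  have "Poly_Mapping.keys (p + q) \<subseteq> ?A" by (rule keys_add)
  then show ?thesis
    using pdiff_superset[of ?A p i] pdiff_superset[of ?A q i] pdiff_superset[of ?A "p + q" i]
    by (simp add: lookup_add distrib_left single_add sum.distrib)
qed

lemma pdiff_single:
  "pdiff i (Poly_Mapping.single m c) =
     Poly_Mapping.single (m - Poly_Mapping.single i 1) (of_nat (Poly_Mapping.lookup m i) * c)"
  by (subst pdiff_superset[of "{m}"]) auto

lemma monomial_shift:
  fixes m k :: monomial
  assumes "Poly_Mapping.lookup m i \<noteq> 0"
  shows "m + k - Poly_Mapping.single i 1 = (m - Poly_Mapping.single i 1) + k"
  using assms
  by (intro poly_mapping_eqI) (auto simp: lookup_add lookup_minus lookup_single when_def)

lemma pdiff_mult_single: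
  "pdiff i (Poly_Mapping.single m c * Poly_Mapping.single k d) =
     pdiff i (Poly_Mapping.single m c) * Poly_Mapping.single k d
     + Poly_Mapping.single m c * pdiff i (Poly_Mapping.single k d)"
proof -
  have 1: "Poly_Mapping.single (m + k - Poly_Mapping.single i 1) (of_nat (Poly_Mapping.lookup m i) * (c * d))
     = Poly_Mapping.single ((m - Poly_Mapping.single i 1) + k) (of_nat (Poly_Mapping.lookup m i) * (c * d))"
    by (cases "Poly_Mapping.lookup m i = 0") (simp_all add: monomial_shift[unfolded One_nat_def])
  have 2: "Poly_Mapping.single (m + k - Poly_Mapping.single i 1) (of_nat (Poly_Mapping.lookup k i) * (c * d))
     = Poly_Mapping.single (m + (k - Poly_Mapping.single i 1)) (of_nat (Poly_Mapping.lookup k i) * (c * d))"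
    by (cases "Poly_Mapping.lookup k i = 0")
       (simp_all add: monomial_shift[of k i m, unfolded add.commute[of _ m] One_nat_def])
  show ?thesis
    using 1 2 by (simp add: mult_single pdiff_single lookup_add distrib_right distrib_left single_add ac_simps)
qed

lemma pdiff_mult: "pdiff i (p * q) = pdiff i p * q + p * pdiff i q"
proof (induction p rule: poly_mapping_single_add_induct)
  case (single m c)
  show ?case
    by (induction q rule: poly_mapping_single_add_induct)
       (simp_all add: pdiff_mult_single pdiff_add algebra_simps)
next
  case (add p p')
  then show ?case by (simp add: pdiff_add algebra_simps)
qed

lemma pdiff_Const: "pdiff i (Const c) = 0"
  by (simp add: Const_def pdiff_single)

lemma pdiff_Var: "pdiff i (Var j) = (if i = j then 1 else 0)"
  by (auto simp: Var_def pdiff_single lookup_single)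

lemma finite_vars: "finite (vars p)"
  by (simp add: vars_def)

lemma pdiff_not_in_vars: "i \<notin> vars p \<Longrightarrow> pdiff i p = 0"
  unfolding pdiff_def vars_def by (intro sum.neutral) (auto simp: in_keys_iff)

lemma finite_pdiff_nonzero: "finite {i. pdiff i p \<noteq> 0}"
  by (rule finite_subset[OF _ finite_vars[of p]]) (use pdiff_not_in_vars in auto)

lemma vfield_eq_sum:
  assumes "finite A" "\<And>i. i \<notin> A \<Longrightarrow> f i * pdiff i p = 0"
  shows "vfield f p = (\<Sum>i\<in>A. f i * pdiff i p)"
  unfolding vfield_def using assms
  by (intro Sum_any.expand_superset) auto

lemma vfield_in_W_X: "vfield f \<in> (W_X :: ('a::field_char_0 polyX \<Rightarrow> 'a polyX) set)"
proof -
  have eq: "vfield f p = (\<Sum>i\<in>A. f i * pdiff i p)"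
    if "finite A" "vars p \<subseteq> A" for A and p :: "'a polyX"
    by (rule vfield_eq_sum) (use that pdiff_not_in_vars in auto)
  have "vfield f (p + q) = vfield f p + vfield f q" for p q :: "'a polyX"
  proof -
    let ?A = "vars p \<union> vars q \<union> vars (p + q)"
    have fA: "finite ?A" by (simp add: finite_vars)
    show ?thesis
      using eq[of ?A p, OF fA] eq[of ?A q, OF fA] eq[of ?A "p + q", OF fA]
      by (simp add: Un_assoc sup.coboundedI2 le_supI1  pdiff_add distrib_left sum.distrib)
  qed
  moreover have L: "vfield f (p * q) = vfield f p * q + p * vfield f q" for p q :: "'a polyX"
  proof -
    let ?A = "vars p \<union> vars q \<union> vars (p * q)"
    have fA: "finite ?A" by (simp add: finite_vars)
    show ?thesis
      using eq[of ?A p, OF fA] eq[of ?A q, OF fA] eq[of ?A "p * q", OF fA]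
      by (simp add: Un_assoc sup.coboundedI2 le_supI1  pdiff_mult algebra_simps sum.distrib sum_distrib_left)
  qed
  moreover have "vfield f (Const c * p) = Const c * vfield f p" for c and p :: "'a polyX"
    unfolding L by (simp add: vfield_def pdiff_Const)
  ultimately show ?thesis by (simp add: W_X_def)
qed

lemma vfield_Var: "vfield f (Var j) = f j"
  by (subst vfield_eq_sum[of "{j}"]) (auto simp: pdiff_Var)

lemma W_X_eqI:
  assumes D: "D \<in> W_X" and E: "E \<in> W_X" and v: "\<And>j. D (Var j) = E (Var j)"
  shows "D = (E :: 'a::field_char_0 polyX \<Rightarrow> 'a polyX)"
proof
  fix p :: "'a polyX"
  note W = D[unfolded W_X_def] E[unfolded W_X_def]
  have one: "F 1 = 0" if "F \<in> W_X" for F :: "'a polyX \<Rightarrow> 'a polyX"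
  proof -
    have "F (1 * 1) = F 1 * 1 + 1 * F 1" using that unfolding W_X_def by blast
    then show ?thesis by simp
  qed
  have pow: "D (Var i ^ k) = E (Var i ^ k)" for i k
    by (induction k) (use W v one[OF D] one[OF E] in \<open>simp_all only: power_0 power_Suc, simp_all\<close>)
  have var_pow: "Poly_Mapping.single (Poly_Mapping.single i k) 1 = (Var i ^ k :: 'a polyX)" for i k
  proof (induction k)
    case (Suc k)
    have "Poly_Mapping.single (Poly_Mapping.single i (Suc k)) 1 =
        (Var i * Poly_Mapping.single (Poly_Mapping.single i k) 1 :: 'a polyX)"
      unfolding Var_def mult_single by (simp flip: single_add)
    then show ?case by (simp only: Suc.IH power_Suc)
  qed simp
  have mono: "D (Poly_Mapping.single m 1) = E (Poly_Mapping.single m 1)" for m :: monomial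
  proof (induction m rule: poly_mapping_single_add_induct)
    case (single i k)
    show ?case by (simp only: var_pow pow)
  next
    case (add m n)
    have "Poly_Mapping.single (m + n) 1 =
        (Poly_Mapping.single m 1 * Poly_Mapping.single n 1 :: 'a polyX)"
      by (simp add: mult_single)
    then show ?case using add W by simp
  qed
  show "D p = E p"
  proof (induction p rule: poly_mapping_single_add_induct)
    case (single m c)
    have eq: "Poly_Mapping.single m c = Const c * Poly_Mapping.single m 1"
      by (simp add: Const_def mult_single)
    have sc: "F (Const c * q) = Const c * F q" if "F \<in> W_X" for F :: "'a polyX \<Rightarrow> 'a polyX" and q
      using that unfolding W_X_def by blast
    show ?case unfolding eq sc[OF D] sc[OF E] mono ..
  next
    case (add p q)
    then show ?case using W by simp
  qed
qed

lemma W_X_eq_range_vfield: "W_X = (range vfield :: ('a::field_char_0 polyX \<Rightarrow> 'a polyX) set)"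
proof
  show "W_X \<subseteq> (range vfield :: ('a polyX \<Rightarrow> 'a polyX) set)"
  proof
    fix D :: "'a polyX \<Rightarrow> 'a polyX"
    assume "D \<in> W_X"
    then have "D = vfield (\<lambda>j. D (Var j))"
      by (rule W_X_eqI) (simp_all add: vfield_in_W_X vfield_Var)
    then show "D \<in> range vfield" by blast
  qed
qed (use vfield_in_W_X in auto)

lemma W_n_eq: "W_n n = {D. \<exists>f. (\<forall>i<n. f i \<in> polyX_upto n) \<and> (\<forall>i\<ge>n. f i = 0) \<and> D = vfield f}"
proof -
  have *: "vfield (\<lambda>i. if i < n then f i else 0) = (\<lambda>p. \<Sum>i<n. f i * pdiff i p)"
    for f :: "nat \<Rightarrow> 'a polyX"
    by (rule ext, subst vfield_eq_sum[of "{..<n}"]) auto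
  have **: "vfield f = (\<lambda>p. \<Sum>i<n. f i * pdiff i p)" if "\<forall>i\<ge>n. f i = 0"
    for f :: "nat \<Rightarrow> 'a polyX"
    by (rule ext, subst vfield_eq_sum[of "{..<n}"]) (use that in auto)
  show ?thesis
  proof (intro set_eqI iffI; clarsimp simp: W_n_def)
    fix f :: "nat \<Rightarrow> 'a polyX"
    assume "\<forall>i<n. f i \<in> polyX_upto n"
    then show "\<exists>fa. (\<forall>i<n. fa i \<in> polyX_upto n) \<and> (\<forall>i\<ge>n. fa i = 0) \<and>
        (\<lambda>p. \<Sum>i<n. f i * pdiff i p) = vfield fa"
      by (intro exI[of _ "\<lambda>i. if i < n then f i else 0"]) (simp add: *)
  next
    fix f :: "nat \<Rightarrow> 'a polyX"
    assume "\<forall>i<n. f i \<in> polyX_upto n" "\<forall>i\<ge>n. f i = 0"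
    then show "\<exists>fa. (\<forall>i<n. fa i \<in> polyX_upto n) \<and>
        vfield f = (\<lambda>p. \<Sum>i<n. fa i * pdiff i p)"
      using ** by blast
  qed
qed

lemma W_inf_subset_W_fin: "W_inf \<subseteq> W_fin"
proof
  fix D :: "'a polyX \<Rightarrow> 'a polyX"
  assume "D \<in> W_inf"
  then obtain n f where f: "\<forall>i\<ge>n. f i = 0" "D = vfield f"
    by (auto simp: W_inf_def W_n_eq)
  have "finite {i. k \<in> vars (f i)}" for k
    by (rule finite_subset[of _ "{..<n}"]) (use f in \<open>auto simp: vars_def not_less\<close>, metis keys_zero empty_iff not_less)
  then show "D \<in> W_fin" using f vfield_in_W_X by (auto simp: W_fin_def)
qed

lemma W_X_add: "D \<in> W_X \<Longrightarrow> D (p + q) = D p + D q"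
  and W_X_scale: "D \<in> W_X \<Longrightarrow> D (Const c * p) = Const c * D p"
  and W_X_mult: "D \<in> W_X \<Longrightarrow> D (p * q) = D p * q + p * D q"
  unfolding W_X_def by blast+

lemma bracket_in_W_X:
  assumes D: "D \<in> W_X" and E: "E \<in> W_X"
  shows "bracket D E \<in> W_X"
proof -
  note D = W_X_add[OF D] W_X_scale[OF D] W_X_mult[OF D]
  note E = W_X_add[OF E] W_X_scale[OF E] W_X_mult[OF E]
  have "bracket D E (p + q) = bracket D E p + bracket D E q" for p q
    unfolding bracket_def D(1) E(1) by (simp add: algebra_simps)
  moreover have "bracket D E (Const c * p) = Const c * bracket D E p" for c p
    unfolding bracket_def D(2) E(2) by (simp add: algebra_simps)
  moreover have "bracket D E (p * q) = bracket D E p * q + p * bracket D E q" for p q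
    unfolding bracket_def D(3) E(3) D(1) E(1) by (simp add: algebra_simps)
  ultimately show ?thesis unfolding W_X_def by blast
qed

lemma polyX_upto_closed:
  fixes p q :: "'a::comm_ring_1 polyX"
  shows "(0 :: 'a polyX) \<in> polyX_upto n"
    and "p \<in> polyX_upto n \<Longrightarrow> q \<in> polyX_upto n \<Longrightarrow> p + q \<in> polyX_upto n"
    and "p \<in> polyX_upto n \<Longrightarrow> q \<in> polyX_upto n \<Longrightarrow> p - q \<in> polyX_upto n"
    and "p \<in> polyX_upto n \<Longrightarrow> q \<in> polyX_upto n \<Longrightarrow> p * q \<in> polyX_upto n"
    and "p \<in> polyX_upto n \<Longrightarrow> Const c * p \<in> polyX_upto n"
proof -
  have keys_sub: "Poly_Mapping.keys (p - q) \<subseteq> Poly_Mapping.keys p \<union> Poly_Mapping.keys q"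
    by (auto simp: in_keys_iff lookup_minus)
  show "(0 :: 'a polyX) \<in> polyX_upto n" by (simp add: polyX_upto_def vars_def)
  show "p \<in> polyX_upto n \<Longrightarrow> q \<in> polyX_upto n \<Longrightarrow> p + q \<in> polyX_upto n"
    unfolding polyX_upto_def vars_def using keys_add[of p q] by blast
  show "p \<in> polyX_upto n \<Longrightarrow> q \<in> polyX_upto n \<Longrightarrow> p - q \<in> polyX_upto n"
    unfolding polyX_upto_def vars_def
    using keys_sub by blast
  have mult: "p * q \<in> polyX_upto n" if "p \<in> polyX_upto n" "q \<in> polyX_upto n" for p q :: "'a polyX"
    unfolding polyX_upto_def vars_def
  proof clarify
    fix i m
    assume m: "m \<in> Poly_Mapping.keys (p * q)" "i \<in> Poly_Mapping.keys m"
    then obtain a b where ab: "m = a + b" "a \<in> Poly_Mapping.keys p" "b \<in> Poly_Mapping.keys q"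
      using keys_mult[of p q] by blast
    with m(2) have "i \<in> Poly_Mapping.keys a \<union> Poly_Mapping.keys b" using keys_add[of a b] by blast
    then show "i < n" using that ab(2,3) unfolding polyX_upto_def vars_def by blast
  qed
  then show "p \<in> polyX_upto n \<Longrightarrow> q \<in> polyX_upto n \<Longrightarrow> p * q \<in> polyX_upto n" .
  show "p \<in> polyX_upto n \<Longrightarrow> Const c * p \<in> polyX_upto n"
    by (rule mult) (auto simp: polyX_upto_def vars_def Const_def split: if_splits)
qed

lemma pdiff_in_polyX_upto:
  assumes "p \<in> polyX_upto n"
  shows "pdiff i p \<in> polyX_upto n"
proof -
  have sum: "(\<Sum>m\<in>A. g m) \<in> polyX_upto n" if "\<forall>m\<in>A. g m \<in> polyX_upto n"
    for A and g :: "monomial \<Rightarrow> 'a polyX"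
    using that by (induction A rule: infinite_finite_induct) (auto intro: polyX_upto_closed)
  have "Poly_Mapping.single (m - Poly_Mapping.single i 1) c \<in> polyX_upto n"
    if "m \<in> Poly_Mapping.keys p" for m and c :: 'a
  proof -
    have "Poly_Mapping.keys (m - Poly_Mapping.single i 1) \<subseteq> Poly_Mapping.keys m"
      by (auto simp: in_keys_iff lookup_minus)
    moreover have "Poly_Mapping.keys m \<subseteq> {..<n}"
      using assms that unfolding polyX_upto_def vars_def by blast
    ultimately show ?thesis unfolding polyX_upto_def vars_def by auto
  qed
  then show ?thesis unfolding pdiff_def by (intro sum) blast
qed

lemma W_n_mono: "m \<le> n \<Longrightarrow> W_n m \<subseteq> W_n n"
  unfolding W_n_eq
proof clarify
  fix f :: "nat \<Rightarrow> 'a polyX"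
  assume mn: "m \<le> n" and f: "\<forall>i<m. f i \<in> polyX_upto m" "\<forall>i\<ge>m. f i = 0"
  have "f i \<in> polyX_upto n" for i
  proof (cases "i < m")
    case True
    then show ?thesis using f(1) mn unfolding polyX_upto_def by fastforce
  qed (use f(2) polyX_upto_closed(1) in auto)
  moreover have "\<forall>i\<ge>n. f i = 0" using f(2) mn by auto
  ultimately show "\<exists>g. (\<forall>i<n. g i \<in> polyX_upto n) \<and> (\<forall>i\<ge>n. g i = 0) \<and> vfield f = vfield g"
    by blast
qed

lemma bracket_in_W_n:
  assumes "D \<in> W_n n" "E \<in> W_n n"
  shows "bracket D E \<in> W_n n"
proof -
  obtain f where f: "\<forall>i<n. f i \<in> polyX_upto n" "\<forall>i\<ge>n. f i = 0" "D = vfield f"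
    using assms(1) by (auto simp: W_n_eq)
  obtain g where g: "\<forall>i<n. g i \<in> polyX_upto n" "\<forall>i\<ge>n. g i = 0" "E = vfield g"
    using assms(2) by (auto simp: W_n_eq)
  define h where "h j = bracket D E (Var j)" for j
  have DE: "bracket D E = vfield h"
    by (rule W_X_eqI) (auto simp: f g bracket_in_W_X vfield_in_W_X vfield_Var h_def)
  have act: "vfield k p \<in> polyX_upto n"
    if k: "\<forall>i<n. k i \<in> polyX_upto n" "\<forall>i\<ge>n. k i = 0" and p: "p \<in> polyX_upto n" for k and p :: "'a polyX"
  proof -
    have "(\<Sum>i<m. k i * pdiff i p) \<in> polyX_upto n" if "m \<le> n" for m
      using that
    proof (induction m)
      case (Suc m)
      then show ?case using k p by (simp add: polyX_upto_closed pdiff_in_polyX_upto)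
    qed (simp add: polyX_upto_closed)
    moreover have "vfield k p = (\<Sum>i<n. k i * pdiff i p)"
      by (rule vfield_eq_sum) (use k in auto)
    ultimately show ?thesis by simp
  qed
  have "h j \<in> polyX_upto n" if "j < n" for j
    unfolding h_def bracket_def f g vfield_Var
    using act f g that by (intro polyX_upto_closed) auto
  moreover have "h j = 0" if "j \<ge> n" for j
    using f g that by (simp add: h_def bracket_def vfield_Var) (simp add: vfield_def pdiff_def)
  ultimately show ?thesis using DE by (auto simp: W_n_eq)
qed

lemma bracket_in_W_inf:
  assumes "D \<in> W_inf" "E \<in> W_inf"
  shows "bracket D E \<in> W_inf"
proof -
  obtain m n where "m \<ge> 1" "D \<in> W_n m" "n \<ge> 1" "E \<in> W_n n"
    using assms by (auto simp: W_inf_def)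
  then have "bracket D E \<in> W_n (max m n)"
    using W_n_mono[of m "max m n"] W_n_mono[of n "max m n"] by (intro bracket_in_W_n) auto
  then show ?thesis using \<open>m \<ge> 1\<close> by (auto simp: W_inf_def intro!: bexI[of _ "max m n"])
qed

end

theory Submission
  imports Defs
begin

text \<open>
  A primitive \<open>a\<close> of \<open>d\<close> must satisfy \<open>\<partial>\<^sub>i a\<^sub>j = (d \<partial>\<^sub>i)(x\<^sub>j)\<close>. Since the \<open>\<partial>\<^sub>i\<close> commute, for each \<open>j\<close> the
  right-hand sides form a closed 1-form; it has only finitely many nonzero components, so it has
  a polynomial potential. The potentials are determined up to constants, and these are fixed by
  the values of \<open>d\<close> on the fields \<open>x\<^sub>i \<partial>\<^sub>i\<close>. The difference \<open>d - ad a\<close> then kills all \<open>\<partial>\<^sub>i\<close> and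
  \<open>x\<^sub>i \<partial>\<^sub>i\<close>. By induction on the degree of a monomial \<open>m \<noteq> 1\<close>, it maps \<open>m \<partial>\<^sub>j\<close> to a field with constant
  coefficients, and such a field cannot have the same weights under all \<open>x\<^sub>i \<partial>\<^sub>i\<close> as \<open>m \<partial>\<^sub>j\<close> unless
  it is 0.
\<close>

section \<open>Partial derivatives of polynomials\<close>

text \<open>Read coefficient by coefficient, differentiation involves no truncated subtraction, so
  identities such as \<open>pdiff_commute\<close> reduce to arithmetic of exponents.\<close>

lemma lookup_pdiff:
  "Poly_Mapping.lookup (pdiff i p) k =
     of_nat (Poly_Mapping.lookup k i + 1) * Poly_Mapping.lookup p (k + Poly_Mapping.single i 1)"
proof (induction p rule: poly_mapping_single_add_induct)
  case (single m c)
  let ?e = "Poly_Mapping.single i (1 :: nat)"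
  show ?case
  proof (cases "Poly_Mapping.lookup m i = 0")
    case True
    then have "m \<noteq> k + ?e" by (metis add_is_0 lookup_add lookup_single_eq zero_neq_one)
    with True show ?thesis by (simp only: pdiff_single lookup_single) simp
  next
    case False
    have "m - ?e + ?e = m"
      using False by (intro poly_mapping_eqI)
        (auto simp: lookup_add lookup_minus lookup_single when_def)
    then have "m - ?e = k \<longleftrightarrow> m = k + ?e" by (metis add_right_imp_eq)
    moreover have "Poly_Mapping.lookup (k + ?e) i = Poly_Mapping.lookup k i + 1"
      by (simp add: lookup_add)
    ultimately show ?thesis
      by (simp only: pdiff_single lookup_single) (auto simp only: when_def mult_zero_right if_True if_False simp_thms)
  qed
next
  case (add p q)
  then show ?case by (simp add: pdiff_add lookup_add distrib_left)
qed

lemma pdiff_zero [simp]: "pdiff i 0 = 0"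
  by (simp add: pdiff_def)

lemma pdiff_minus: "pdiff i (p - q) = pdiff i p - pdiff i q"
  using pdiff_add[of i "p - q" q] by (simp add: algebra_simps)

lemma pdiff_commute: "pdiff i (pdiff k p) = pdiff k (pdiff i p)"
proof (cases "i = k")
  case False
  then show ?thesis
    by (intro poly_mapping_eqI) (simp add: lookup_pdiff lookup_add lookup_single ac_simps)
qed simp

text \<open>In characteristic 0 a nonzero exponent cannot annihilate a coefficient, so every
  monomial containing the variable \<open>i\<close> leaves a trace in the derivative.\<close>

lemma pdiff_eq_0_iff:
  fixes p :: "'a::field_char_0 polyX"
  shows "pdiff i p = 0 \<longleftrightarrow> i \<notin> vars p"
proof
  assume 0: "pdiff i p = 0"
  show "i \<notin> vars p"
  proof
    assume "i \<in> vars p"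
    then obtain m where m: "m \<in> Poly_Mapping.keys p" "Poly_Mapping.lookup m i \<noteq> 0"
      by (auto simp: vars_def in_keys_iff)
    let ?k = "m - Poly_Mapping.single i 1"
    have "?k + Poly_Mapping.single i 1 = m"
      using m(2) by (intro poly_mapping_eqI)
        (auto simp: lookup_add lookup_minus lookup_single when_def)
    then have "Poly_Mapping.lookup (pdiff i p) ?k =
        of_nat (Poly_Mapping.lookup ?k i + 1) * Poly_Mapping.lookup p m"
      by (simp only: lookup_pdiff)
    moreover have "of_nat (Poly_Mapping.lookup ?k i + 1) \<noteq> (0 :: 'a)"
      unfolding of_nat_eq_0_iff by simp
    ultimately show False using 0 m(1) by (simp add: in_keys_iff)
  qed
qed (rule pdiff_not_in_vars)

lemma pdiff_all_zero_Const:
  fixes p :: "'a::field_char_0 polyX"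
  assumes "\<And>i. pdiff i p = 0"
  shows "\<exists>c. p = Const c"
proof -
  have "vars p = {}" using assms by (auto simp: pdiff_eq_0_iff)
  then have "Poly_Mapping.keys p \<subseteq> {0}" by (auto simp: vars_def)
  then have "p = Const (Poly_Mapping.lookup p 0)"
    unfolding Const_def
    by (intro poly_mapping_eqI) (auto simp: lookup_single when_def in_keys_iff)
  then show ?thesis ..
qed

section \<open>Formal integration and exactness of closed 1-forms\<close>

definition antideriv :: "nat \<Rightarrow> 'a::field_char_0 polyX \<Rightarrow> 'a polyX" where
  "antideriv i p = (\<Sum>m \<in> Poly_Mapping.keys p.
     Poly_Mapping.single (m + Poly_Mapping.single i 1)
       (Poly_Mapping.lookup p m / of_nat (Poly_Mapping.lookup m i + 1)))"

lemma antideriv_superset: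
  assumes "finite A" "Poly_Mapping.keys p \<subseteq> A"
  shows "antideriv i p = (\<Sum>m \<in> A. Poly_Mapping.single (m + Poly_Mapping.single i 1)
           (Poly_Mapping.lookup p m / of_nat (Poly_Mapping.lookup m i + 1)))"
  unfolding antideriv_def using assms
  by (intro sum.mono_neutral_left) (auto simp: in_keys_iff)

lemma antideriv_zero [simp]: "antideriv i 0 = 0"
  by (simp add: antideriv_def)

lemma antideriv_add: "antideriv i (p + q) = antideriv i p + antideriv i q"
proof -
  let ?A = "Poly_Mapping.keys p \<union> Poly_Mapping.keys q"
  have "Poly_Mapping.keys (p + q) \<subseteq> ?A" by (rule keys_add)
  then show ?thesis
    using antideriv_superset[of ?A p i] antideriv_superset[of ?A q i]
      antideriv_superset[of ?A "p + q" i]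
    by (simp add: lookup_add add_divide_distrib single_add sum.distrib del: of_nat_add of_nat_Suc)
qed

lemma antideriv_single:
  "antideriv i (Poly_Mapping.single m c) =
     Poly_Mapping.single (m + Poly_Mapping.single i 1) (c / of_nat (Poly_Mapping.lookup m i + 1))"
  by (subst antideriv_superset[of "{m}"]) auto

lemma pdiff_antideriv: "pdiff i (antideriv i p) = p"
proof (induction p rule: poly_mapping_single_add_induct)
  case (single m c)
  have "of_nat (Poly_Mapping.lookup m i + 1) \<noteq> (0 :: 'a)"
    unfolding of_nat_eq_0_iff by simp
  then show ?case
    by (simp add: antideriv_single pdiff_single lookup_add)
next
  case (add p q)
  then show ?case by (simp add: antideriv_add pdiff_add)
qed

lemma pdiff_antideriv_commute:
  assumes "i \<noteq> k"
  shows "pdiff i (antideriv k p) = antideriv k (pdiff i p)"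
proof (induction p rule: poly_mapping_single_add_induct)
  case (single m c)
  have "m + Poly_Mapping.single k 1 - Poly_Mapping.single i 1
      = m - Poly_Mapping.single i 1 + Poly_Mapping.single k 1"
    if "Poly_Mapping.lookup m i \<noteq> 0"
    by (rule monomial_shift[OF that])
  then show ?case using assms
    by (cases "Poly_Mapping.lookup m i = 0")
      (auto simp: antideriv_single pdiff_single lookup_add lookup_minus lookup_single)
next
  case (add p q)
  then show ?case by (simp add: antideriv_add pdiff_add)
qed

text \<open>An algebraic Poincare lemma, by induction on a bound for the nonzero components:
  subtracting the differential of the integral of \<open>g N\<close> removes component
  \<open>N\<close> and preserves closedness.\<close>

lemma closed_form_exact:
  fixes g :: "nat \<Rightarrow> 'a::field_char_0 polyX"
  assumes "\<And>i k. pdiff i (g k) = pdiff k (g i)" "\<And>i. i \<ge> N \<Longrightarrow> g i = 0"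
  shows "\<exists>p. \<forall>i. pdiff i p = g i"
  using assms
proof (induction N arbitrary: g)
  case 0
  then show ?case by (intro exI[of _ 0]) simp
next
  case (Suc N)
  let ?h = "antideriv N (g N)"
  have "\<exists>p. \<forall>i. pdiff i p = g i - pdiff i ?h"
  proof (rule Suc.IH)
    show "pdiff i (g k - pdiff k ?h) = pdiff k (g i - pdiff i ?h)" for i k
      by (simp add: pdiff_minus Suc.prems(1)[of i k] pdiff_commute[of i k])
    show "g i - pdiff i ?h = 0" if "i \<ge> N" for i
    proof (cases "i = N")
      case True
      then show ?thesis by (simp add: pdiff_antideriv)
    next
      case False
      \<comment> \<open>For \<open>i > N\<close>, closedness gives
        \<open>pdiff i (g N) = pdiff N (g i) = 0\<close>, so the integral does not bring component
        \<open>i\<close> back.\<close>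
      then show ?thesis
        using that Suc.prems(2)[of i] Suc.prems(1)[of i N]
        by (simp add: pdiff_antideriv_commute)
    qed
  qed
  then obtain p where "\<forall>i. pdiff i p = g i - pdiff i ?h" by blast
  then have "\<forall>i. pdiff i (p + ?h) = g i" by (simp add: pdiff_add)
  then show ?case ..
qed

section \<open>Vector fields with a single component\<close>

definition field1 :: "'a::field_char_0 polyX \<Rightarrow> nat \<Rightarrow> 'a polyX \<Rightarrow> 'a polyX" where
  "field1 f j = (\<lambda>p. f * pdiff j p)"

lemma field1_Var: "field1 f j (Var l) = (if j = l then f else 0)"
  by (simp add: field1_def pdiff_Var)

lemma W_inf_subset_W_X: "x \<in> W_inf \<Longrightarrow> x \<in> W_X"
  using W_inf_subset_W_fin by (auto simp: W_fin_def)

text \<open>Finitely many polynomials involve finitely many variables, so a bound on the nonzero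
  components already places the field in some \<open>W_n\<close>.\<close>

lemma W_inf_I:
  assumes "\<And>i. i \<ge> n \<Longrightarrow> f i = 0"
  shows "vfield f \<in> W_inf"
proof -
  let ?V = "{..<n} \<union> (\<Union>i<n. vars (f i))"
  have "finite ?V" by (simp add: finite_vars)
  then obtain N where N: "?V \<subseteq> {..<N}"
    unfolding finite_nat_set_iff_bounded by blast
  \<comment> \<open>\<open>Suc N\<close> instead of \<open>N\<close>, because the union defining
    \<open>W_inf\<close> starts at 1.\<close>
  have "f i \<in> polyX_upto (Suc N)" for i
  proof (cases "i < n")
    case True
    then have "vars (f i) \<subseteq> {..<N}" using N by blast
    then show ?thesis by (auto simp: polyX_upto_def)
  next
    case False
    then show ?thesis using assms polyX_upto_closed(1) by simp
  qed
  moreover have "f i = 0" if "i \<ge> Suc N" for i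
  proof -
    have "i \<ge> n" using N that by (meson UnI1 Suc_leD lessThan_iff linorder_not_less subsetD)
    then show ?thesis by (rule assms)
  qed
  ultimately have "vfield f \<in> W_n (Suc N)" unfolding W_n_eq by blast
  then show ?thesis unfolding W_inf_def by force
qed

lemma field1_W_inf: "field1 f j \<in> W_inf"
proof -
  have "field1 f j = vfield (\<lambda>i. if i = j then f else 0)"
    by (rule ext, subst vfield_eq_sum[of "{j}"]) (auto simp: field1_def)
  also have "\<dots> \<in> W_inf" by (rule W_inf_I[of "Suc j"]) auto
  finally show ?thesis .
qed

lemmas field1_W_X = W_inf_subset_W_X[OF field1_W_inf]

lemma W_inf_add:
  assumes "x \<in> W_inf" "y \<in> W_inf"
  shows "(\<lambda>p. x p + y p) \<in> W_inf"
proof -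
  obtain m f where f: "\<And>i. i \<ge> m \<Longrightarrow> f i = 0" "x = vfield f"
    using assms(1) by (auto simp: W_inf_def W_n_eq)
  obtain n g where g: "\<And>i. i \<ge> n \<Longrightarrow> g i = 0" "y = vfield g"
    using assms(2) by (auto simp: W_inf_def W_n_eq)
  have "(\<lambda>p. x p + y p) = vfield (\<lambda>i. f i + g i)"
  proof
    fix p :: "'a polyX"
    let ?A = "{..<max m n}"
    have "x p = (\<Sum>i\<in>?A. f i * pdiff i p)" unfolding f(2)
      by (rule vfield_eq_sum) (auto simp: f(1))
    moreover have "y p = (\<Sum>i\<in>?A. g i * pdiff i p)" unfolding g(2)
      by (rule vfield_eq_sum) (auto simp: g(1))
    moreover have "vfield (\<lambda>i. f i + g i) p = (\<Sum>i\<in>?A. (f i + g i) * pdiff i p)"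
      by (rule vfield_eq_sum) (auto simp: f(1) g(1))
    ultimately show "x p + y p = vfield (\<lambda>i. f i + g i) p"
      by (simp add: sum.distrib distrib_right)
  qed
  also have "\<dots> \<in> W_inf" by (rule W_inf_I[of "max m n"]) (simp add: f(1) g(1))
  finally show ?thesis .
qed

lemma W_inf_finite_support:
  assumes "x \<in> W_inf"
  obtains N where "\<And>i. i \<ge> N \<Longrightarrow> x (Var i) = 0" "\<And>i j. i \<ge> N \<Longrightarrow> pdiff i (x (Var j)) = 0"
proof -
  obtain n f where f: "\<forall>i<n. f i \<in> polyX_upto n" "\<forall>i\<ge>n. f i = 0" "x = vfield f"
    using assms by (auto simp: W_inf_def W_n_eq)
  show thesis
  proof (rule that)
    show "x (Var i) = 0" if "i \<ge> n" for i
      using f that by (simp add: vfield_Var)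
    show "pdiff i (x (Var j)) = 0" if "i \<ge> n" for i j
    proof (cases "j < n")
      case True
      then have "vars (f j) \<subseteq> {..<n}" using f(1) by (auto simp: polyX_upto_def)
      then show ?thesis unfolding f(3) vfield_Var using that by (intro pdiff_not_in_vars) auto
    qed (simp add: f vfield_Var)
  qed
qed

lemma W_X_zero: "D \<in> W_X \<Longrightarrow> D 0 = 0"
  using W_X_add[of D 0 0] by simp

lemma W_X_Const:
  assumes "D \<in> W_X"
  shows "D (Const c) = 0"
proof -
  obtain f where "D = vfield f" using assms W_X_eq_range_vfield by blast
  then show ?thesis by (simp add: vfield_def pdiff_Const)
qed

lemma W_X_minus: "D \<in> W_X \<Longrightarrow> D (p - q) = D p - D q"
  using W_X_add[of D "p - q" q] by (simp add: algebra_simps)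

lemma W_X_diff:
  assumes D: "D \<in> W_X" and E: "E \<in> W_X"
  shows "(\<lambda>p. D p - E p) \<in> W_X"
  unfolding W_X_def
  by (simp add: W_X_add[OF D] W_X_add[OF E] W_X_mult[OF D] W_X_mult[OF E]
      W_X_Const[OF D] W_X_Const[OF E] algebra_simps)

lemma W_X_smult:
  assumes D: "D \<in> W_X"
  shows "(\<lambda>p. f * D p) \<in> W_X"
  unfolding W_X_def
  by (simp add: W_X_add[OF D] W_X_mult[OF D] W_X_Const[OF D] algebra_simps)

lemma W_X_0: "(\<lambda>p. 0) \<in> W_X"
  by (simp add: W_X_def)

lemma field1_one: "field1 1 i = pdiff i"
  by (simp add: field1_def)

lemma Const_0: "Const 0 = 0" and Const_1: "Const 1 = 1"
  by (simp_all add: Const_def)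

lemma Const_eq_0_iff: "Const c = 0 \<longleftrightarrow> c = 0"
  by (metis Const_def Const_0 lookup_single_eq lookup_zero)

lemma pdiff_one [simp]: "pdiff i 1 = 0"
  using pdiff_Const[of i 1] by (simp add: Const_1)

section \<open>Brackets with partial derivatives and Euler fields\<close>

lemma Var_mult_pdiff_single:
  "Var i * pdiff i (Poly_Mapping.single m c) =
     Const (of_nat (Poly_Mapping.lookup m i)) * Poly_Mapping.single m c"
proof (cases "Poly_Mapping.lookup m i = 0")
  case False
  then have "Poly_Mapping.single i 1 + (m - Poly_Mapping.single i 1) = m"
    by (intro poly_mapping_eqI) (auto simp: lookup_add lookup_minus lookup_single when_def)
  then show ?thesis unfolding pdiff_single Var_def Const_def mult_single by simp
qed (simp add: pdiff_single Const_0)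

lemma bracket_pdiff_field1:
  "bracket (field1 1 i) (field1 f j) = field1 (pdiff i f) j"
  by (rule W_X_eqI[OF bracket_in_W_X[OF field1_W_X field1_W_X] field1_W_X])
    (auto simp: bracket_def field1_Var W_X_zero[OF field1_W_X], simp_all add: field1_def)

text \<open>Monomial fields are common eigenvectors of the Euler fields
  \<open>field1 (Var i) i\<close>; the eigenvalues are the weights compared in
  \<open>monomial_vanish\<close>.\<close>

lemma bracket_Euler_monomial:
  "bracket (field1 (Var i) i) (field1 (Poly_Mapping.single m c) j) =
     (\<lambda>p. Const (of_nat (Poly_Mapping.lookup m i) - (if i = j then 1 else 0)) *
        field1 (Poly_Mapping.single m c) j p)"
proof (rule W_X_eqI)
  have C: "Const (a - b) = Const a - Const b" for a b :: 'a
    by (simp add: Const_def single_diff)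
  fix l
  show "bracket (field1 (Var i) i) (field1 (Poly_Mapping.single m c) j) (Var l) =
     Const (of_nat (Poly_Mapping.lookup m i) - (if i = j then 1 else 0)) *
        field1 (Poly_Mapping.single m c) j (Var l)"
    by (simp add: bracket_def field1_def pdiff_Var Var_mult_pdiff_single C Const_0 Const_1
        algebra_simps)
qed (simp_all add: bracket_in_W_X field1_W_X W_X_smult)

section \<open>Derivations of \<open>W_inf\<close> with values in \<open>W_X\<close>\<close>

text \<open>Values are only required to lie in \<open>W_X\<close>, so that a bracket with an
  arbitrary element of \<open>W_X\<close> can be subtracted before anything is known about the
  variables in its coefficients.\<close>

locale W_inf_derivation =
  fixes d :: "('a::field_char_0 polyX \<Rightarrow> 'a polyX) \<Rightarrow> ('a polyX \<Rightarrow> 'a polyX)"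
  assumes into_W_X: "x \<in> W_inf \<Longrightarrow> d x \<in> W_X"
    and additive: "x \<in> W_inf \<Longrightarrow> y \<in> W_inf \<Longrightarrow> d (\<lambda>p. x p + y p) = (\<lambda>p. d x p + d y p)"
    and scale: "x \<in> W_inf \<Longrightarrow> d (\<lambda>p. Const c * x p) = (\<lambda>p. Const c * d x p)"
    and leibniz: "x \<in> W_inf \<Longrightarrow> y \<in> W_inf \<Longrightarrow>
      d (bracket x y) = (\<lambda>p. bracket (d x) y p + bracket x (d y) p)"
begin

lemma zero: "d (\<lambda>p. 0) = (\<lambda>p. 0)"
  using scale[OF field1_W_inf[of 0 0], of 0] by (simp add: Const_0)

lemma field1_zero: "d (field1 0 j) = (\<lambda>p. 0)"
  using zero by (simp add: field1_def)

text \<open>Apply \<open>d\<close> to \<open>bracket_pdiff_field1\<close> and evaluate at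
  \<open>Var l\<close>; the term containing \<open>pdiff i (Var l)\<close> drops out because
  derivations kill constants. Closedness, finiteness and constancy of components all follow from
  this identity.\<close>

lemma pdiff_d_Var:
  "pdiff i (d (field1 f j) (Var l)) =
     d (field1 (pdiff i f) j) (Var l) + field1 f j (d (field1 1 i) (Var l))
     - d (field1 1 i) (field1 f j (Var l))"
proof -
  have "d (field1 (pdiff i f) j) (Var l) =
      bracket (d (field1 1 i)) (field1 f j) (Var l) + bracket (field1 1 i) (d (field1 f j)) (Var l)"
    by (simp flip: bracket_pdiff_field1 add: leibniz field1_W_inf)
  moreover have "d (field1 f j) (pdiff i (Var l)) = 0"
    using W_X_Const[OF into_W_X[OF field1_W_inf], of f j "if i = l then 1 else 0"]
    by (auto simp: pdiff_Var Const_0 Const_1 split: if_splits)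
  ultimately show ?thesis by (simp add: bracket_def field1_one)
qed

lemma pdiff_closed:
  "pdiff i (d (field1 1 k) (Var j)) = pdiff k (d (field1 1 i) (Var j))"
proof -
  have "d (field1 1 i) (field1 1 k (Var j)) = 0"
    using W_X_Const[OF into_W_X[OF field1_W_inf], of 1 i "if k = j then 1 else 0"]
    by (auto simp: field1_Var Const_0 Const_1 split: if_splits)
  then show ?thesis
    using pdiff_d_Var[of i 1 k j]
    by (simp add: field1_zero) (simp add: field1_one)
qed

text \<open>For large \<open>i\<close> the fields \<open>d \<partial>\<^sub>j\<close> and \<open>d (x\<^sub>j \<partial>\<^sub>j)\<close> are free of \<open>x\<^sub>i\<close>, so the coefficient \<open>g\<close> of
  \<open>\<partial>\<^sub>j\<close> in \<open>d \<partial>\<^sub>i\<close> satisfies both \<open>\<partial>\<^sub>j g = 0\<close> and \<open>g = x\<^sub>j \<partial>\<^sub>j g\<close>.\<close>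

lemma pdiff_components_finite:
  assumes "\<And>x. x \<in> W_inf \<Longrightarrow> d x \<in> W_inf"
  shows "\<exists>N. \<forall>i\<ge>N. d (field1 1 i) (Var j) = 0"
proof -
  obtain N1 where N1: "\<And>i l. i \<ge> N1 \<Longrightarrow> pdiff i (d (field1 1 j) (Var l)) = 0"
    using W_inf_finite_support[OF assms[OF field1_W_inf]] by metis
  obtain N2 where N2: "\<And>i l. i \<ge> N2 \<Longrightarrow> pdiff i (d (field1 (Var j) j) (Var l)) = 0"
    using W_inf_finite_support[OF assms[OF field1_W_inf]] by metis
  \<comment> \<open>The bound \<open>Suc j\<close> forces \<open>i \<noteq> j\<close>, hence
    \<open>pdiff i (Var j) = 0\<close>.\<close>
  have "d (field1 1 i) (Var j) = 0" if i: "i \<ge> max (max N1 N2) (Suc j)" for i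
  proof -
    have "pdiff j (d (field1 1 i) (Var j)) = 0"
      using N1[of i j] i pdiff_closed[of i j j] by simp
    moreover have "pdiff i (Var j) = (0 :: 'a polyX)" using i by (simp add: pdiff_Var)
    ultimately show ?thesis
      using N2[of i j] i pdiff_d_Var[of i "Var j" j j]
      by (simp add: field1_zero field1_Var) (simp add: field1_def)
  qed
  then show ?thesis by blast
qed

text \<open>Every term on the right of \<open>pdiff_d_Var\<close> vanishes here, so all partial
  derivatives of the component are 0.\<close>

lemma Const_component:
  assumes "\<And>i. d (field1 1 i) = (\<lambda>p. 0)" "\<And>i. d (field1 (pdiff i f) j) = (\<lambda>p. 0)"
  obtains c where "d (field1 f j) (Var l) = Const c"
  using pdiff_all_zero_Const[of "d (field1 f j) (Var l)"]
  by (metis (no_types) assms pdiff_d_Var W_X_zero[OF field1_W_X] add_0 diff_0_right)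

text \<open>All components are constant by \<open>Const_component\<close>. Those with index
  \<open>j \<noteq> i\<close> vanish because the Euler fields of \<open>i\<close> and
  \<open>j\<close> commute: applying \<open>d\<close> to their zero bracket and evaluating at
  \<open>Var j\<close> leaves exactly that component.\<close>

lemma Euler_image:
  assumes "\<And>i. d (field1 1 i) = (\<lambda>p. 0)"
  shows "\<exists>c. d (field1 (Var i) i) = field1 (Const c) i"
proof -
  have 0: "d (field1 (pdiff k (Var l)) l) = (\<lambda>p. 0)" for k l
    by (simp add: pdiff_Var assms field1_zero)
  obtain c where c: "d (field1 (Var i) i) (Var i) = Const c"
    using Const_component[OF assms 0] by metis
  have off: "d (field1 (Var i) i) (Var j) = 0" if "i \<noteq> j" for j
  proof -
    obtain a where a: "d (field1 (Var i) i) (Var j) = Const a"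
      using Const_component[OF assms 0] by metis
    obtain b where b: "d (field1 (Var j) j) (Var j) = Const b"
      using Const_component[OF assms 0] by metis
    have "bracket (field1 (Var i) i) (field1 (Var j) j) = (\<lambda>p. 0 :: 'a polyX)"
      by (rule W_X_eqI[OF bracket_in_W_X[OF field1_W_X field1_W_X] W_X_0])
        (use that in \<open>simp add: bracket_def field1_def pdiff_Var\<close>)
    then have "d (bracket (field1 (Var i) i) (field1 (Var j) j)) = (\<lambda>p. 0)"
      by (simp only: zero)
    then have "bracket (d (field1 (Var i) i)) (field1 (Var j) j) (Var j) +
        bracket (field1 (Var i) i) (d (field1 (Var j) j)) (Var j) = 0"
      unfolding leibniz[OF field1_W_inf field1_W_inf] by (rule fun_cong)
    then show ?thesis using that
      by (simp add: bracket_def field1_Var a b W_X_Const[OF field1_W_X]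
          W_X_zero[OF into_W_X[OF field1_W_inf]])
  qed
  have "d (field1 (Var i) i) = field1 (Const c) i"
    by (rule W_X_eqI) (auto simp: into_W_X field1_W_inf field1_W_X field1_Var c off)
  then show ?thesis ..
qed

lemma monomial_vanish:
  assumes "\<And>i. d (field1 1 i) = (\<lambda>p. 0)" "\<And>i. d (field1 (Var i) i) = (\<lambda>p. 0)"
  shows "d (field1 (Poly_Mapping.single m c) j) = (\<lambda>p. 0)"
\<comment> \<open>The measure is the total degree; \<open>c\<close> is generalised because
  differentiation changes the coefficient.\<close>
proof (induction "\<Sum>k\<in>Poly_Mapping.keys m. Poly_Mapping.lookup m k" arbitrary: m c
    rule: less_induct)
  case less
  let ?M = "Poly_Mapping.single m c"
  let ?v = "d (field1 ?M j)"
  show ?case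
  proof (cases "m = 0")
    case True
    have "field1 ?M j = (\<lambda>p. Const c * field1 1 j p)"
      by (simp add: True field1_def Const_def)
    then show ?thesis by (simp add: scale field1_W_inf assms(1))
  next
    case False
    have smaller: "d (field1 (pdiff i ?M) j) = (\<lambda>p. 0)" for i
    proof (cases "Poly_Mapping.lookup m i = 0")
      case True
      then show ?thesis by (simp add: pdiff_single field1_zero)
    next
      case False
      let ?m = "m - Poly_Mapping.single i 1"
      have "(\<Sum>k\<in>Poly_Mapping.keys ?m. Poly_Mapping.lookup ?m k)
          = (\<Sum>k\<in>Poly_Mapping.keys m. Poly_Mapping.lookup ?m k)"
        by (rule sum.mono_neutral_left) (auto simp: in_keys_iff lookup_minus)
      also have "\<dots> < (\<Sum>k\<in>Poly_Mapping.keys m. Poly_Mapping.lookup m k)"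
        using False by (intro sum_strict_mono_ex1)
          (auto simp: lookup_minus in_keys_iff intro!: bexI[of _ i])
      finally show ?thesis unfolding pdiff_single by (rule less)
    qed
    have "?v (Var l) = 0" for l
    proof -
      obtain a where a: "?v (Var l) = Const a"
        using Const_component[OF assms(1) smaller] by metis
      have "a = 0"
      proof (rule ccontr)
        assume "a \<noteq> 0"
        \<comment> \<open>Under the Euler field of \<open>i\<close>, a constant component along
          \<open>l\<close> has weight -1 if \<open>i = l\<close> and 0 otherwise. It must equal the
          weight of \<open>field1 ?M j\<close>, and characteristic 0 turns this into an equation of
          natural numbers.\<close>
        have weight: "Poly_Mapping.lookup m i + (if i = l then 1 else 0) = (if i = j then 1 else 0)"
          for i
        proof -
          let ?w = "of_nat (Poly_Mapping.lookup m i) - (if i = j then 1 else 0) :: 'a"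
          let ?E = "field1 (Var i) i"
          have "Const ?w * ?v (Var l) = d (bracket ?E (field1 ?M j)) (Var l)"
            by (simp only: bracket_Euler_monomial scale field1_W_inf)
          also have "\<dots> = bracket ?E ?v (Var l)"
            by (subst leibniz)
              (simp_all add: field1_W_inf assms(2) bracket_def W_X_zero[OF field1_W_X])
          also have "\<dots> = - (if i = l then ?v (Var l) else 0)"
            by (simp add: bracket_def a W_X_Const[OF field1_W_X] field1_Var
                W_X_zero[OF into_W_X[OF field1_W_inf]])
          finally have "Const (?w * a + (if i = l then a else 0)) = 0"
            by (simp add: a Const_def mult_single single_add split: if_splits)
          then have "(?w + (if i = l then 1 else 0)) * a = 0"
            unfolding Const_eq_0_iff by (simp add: algebra_simps split: if_splits)
          with \<open>a \<noteq> 0\<close> have "?w + (if i = l then 1 else 0) = 0"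
            unfolding mult_eq_0_iff by blast
          then have "(of_nat (Poly_Mapping.lookup m i + (if i = l then 1 else 0)) :: 'a)
              = of_nat (if i = j then 1 else 0)"
            by (simp add: algebra_simps split: if_splits)
          then show ?thesis unfolding of_nat_eq_iff .
        qed
        \<comment> \<open>At \<open>i = l\<close> the left side is at least 1, which forces
          \<open>l = j\<close>; the two indicator terms then cancel and every exponent is 0.\<close>
        have "l = j" using weight[of l] by (simp split: if_splits)
        then have "Poly_Mapping.lookup m i = 0" for i using weight[of i] by simp
        then have "m = 0" by (intro poly_mapping_eqI) simp
        with False show False ..
      qed
      then show ?thesis by (simp add: a Const_0)
    qed
    then show ?thesis by (intro W_X_eqI) (simp_all add: into_W_X field1_W_inf W_X_0)
  qed
qed

lemma vanish:
  assumes "\<And>i. d (field1 1 i) = (\<lambda>p. 0)" "\<And>i. d (field1 (Var i) i) = (\<lambda>p. 0)"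
    and x: "x \<in> W_inf"
  shows "d x = (\<lambda>p. 0)"
proof -
  have field1: "d (field1 f j) = (\<lambda>p. 0)" for f j
  proof (induction f rule: poly_mapping_single_add_induct)
    case (add p q)
    have "field1 (p + q) j = (\<lambda>r. field1 p j r + field1 q j r)"
      by (simp add: field1_def distrib_right)
    then show ?case using add.IH by (simp add: additive field1_W_inf)
  qed (rule monomial_vanish[OF assms(1,2)])
  obtain n f where f: "x = (\<lambda>p. \<Sum>i<n. f i * pdiff i p)"
    using x by (auto simp: W_inf_def W_n_def)
  \<comment> \<open>Membership in \<open>W_inf\<close> is carried along because
    \<open>additive\<close> applies only there.\<close>
  have "(\<lambda>p. \<Sum>i<k. f i * pdiff i p) \<in> W_inf \<and> d (\<lambda>p. \<Sum>i<k. f i * pdiff i p) = (\<lambda>p. 0)" for k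
  proof (induction k)
    case 0
    then show ?case using field1_W_inf[of 0 0] by (simp add: zero field1_def)
  next
    case (Suc k)
    have eq: "(\<lambda>p. \<Sum>i<Suc k. f i * pdiff i p) =
        (\<lambda>p. (\<Sum>i<k. f i * pdiff i p) + field1 (f k) k p)"
      by (simp add: field1_def)
    show ?case unfolding eq
      using Suc by (simp add: additive field1_W_inf field1 W_inf_add)
  qed
  then show ?thesis using f by blast
qed

text \<open>By the Jacobi identity, bracketing with \<open>a\<close> is itself a derivation.\<close>

lemma minus_ad:
  assumes a: "a \<in> W_X"
  shows "W_inf_derivation (\<lambda>x p. d x p - bracket x a p)"
proof
  fix x y :: "'a polyX \<Rightarrow> 'a polyX" and c :: 'a
  assume x: "x \<in> W_inf"
  show "(\<lambda>p. d x p - bracket x a p) \<in> W_X"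
    using x by (intro W_X_diff bracket_in_W_X into_W_X W_inf_subset_W_X a)
  show "(\<lambda>p. d (\<lambda>p. Const c * x p) p - bracket (\<lambda>p. Const c * x p) a p) =
      (\<lambda>p. Const c * (d x p - bracket x a p))"
    using x by (simp add: scale bracket_def W_X_scale[OF a] algebra_simps)
  assume y: "y \<in> W_inf"
  show "(\<lambda>p. d (\<lambda>p. x p + y p) p - bracket (\<lambda>p. x p + y p) a p) =
      (\<lambda>p. d x p - bracket x a p + (d y p - bracket y a p))"
    using x y by (simp add: additive bracket_def W_X_add[OF a] algebra_simps)
  show "(\<lambda>p. d (bracket x y) p - bracket (bracket x y) a p) =
      (\<lambda>p. bracket (\<lambda>p. d x p - bracket x a p) y p + bracket x (\<lambda>p. d y p - bracket y a p) p)"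
    unfolding leibniz[OF x y]
    by (simp add: bracket_def W_X_minus[OF a] W_X_minus[OF W_inf_subset_W_X[OF x]]
        W_X_minus[OF W_inf_subset_W_X[OF y]]) (simp add: algebra_simps)
qed

end

section \<open>Construction of the element of \<open>W_fin\<close>\<close>

theorem theorem1:
  fixes d :: "('a::field_char_0 polyX \<Rightarrow> 'a polyX) \<Rightarrow> ('a polyX \<Rightarrow> 'a polyX)"
  assumes "lie_derivation_on W_inf d"
  shows "\<exists>a\<in>W_fin. \<forall>x\<in>W_inf. d x = bracket x a"
proof -
  have W: "d x \<in> W_inf" if "x \<in> W_inf" for x
    using assms that by (auto simp: lie_derivation_on_def)
  interpret d: W_inf_derivation d
    using assms W_inf_subset_W_X by unfold_locales (auto simp: lie_derivation_on_def)
  have "\<exists>p. \<forall>i. pdiff i p = d (field1 1 i) (Var j)" for j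
  proof -
    obtain N where "\<forall>i\<ge>N. d (field1 1 i) (Var j) = 0"
      using d.pdiff_components_finite W by blast
    then show ?thesis by (intro closed_form_exact d.pdiff_closed) auto
  qed
  then obtain P where P: "\<And>i j. pdiff i (P j) = d (field1 1 i) (Var j)" by metis

  \<comment> \<open>Stated for any family of potentials, since it serves \<open>P\<close> first and
    then the corrected family \<open>A\<close>.\<close>
  have kills: "(\<lambda>p. d (field1 1 i) p - bracket (field1 1 i) (vfield Q) p) = (\<lambda>p. 0)"
    if Q: "\<And>i j. pdiff i (Q j) = d (field1 1 i) (Var j)" for Q i
  proof (rule W_X_eqI)
    fix j
    have "vfield Q (field1 1 i (Var j)) = 0"
      using W_X_Const[OF vfield_in_W_X, of Q "if i = j then 1 else 0"]
      by (auto simp: field1_Var Const_0 Const_1 split: if_splits)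
    then show "d (field1 1 i) (Var j) - bracket (field1 1 i) (vfield Q) (Var j) = 0"
      by (simp add: bracket_def vfield_Var field1_one Q)
  qed (auto intro!: W_X_diff W_X_0 bracket_in_W_X vfield_in_W_X field1_W_X d.into_W_X field1_W_inf)

  interpret P: W_inf_derivation "\<lambda>x p. d x p - bracket x (vfield P) p"
    by (rule d.minus_ad[OF vfield_in_W_X])
  obtain c where c: "\<And>i. (\<lambda>p. d (field1 (Var i) i) p - bracket (field1 (Var i) i) (vfield P) p)
      = field1 (Const (c i)) i"
    using P.Euler_image[OF kills[OF P]] by metis

  \<comment> \<open>The bracket of \<open>field1 (Var i) i\<close> with
    \<open>field1 (Const (c i)) i\<close> is \<open>- field1 (Const (c i)) i\<close>, so subtracting
    the constants \<open>c j\<close> from the potentials cancels the remaining values on Euler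
    fields.\<close>
  define A where "A j = P j - Const (c j)" for j
  have A: "pdiff i (A j) = d (field1 1 i) (Var j)" for i j
    by (simp add: A_def pdiff_minus P pdiff_Const)
  interpret A: W_inf_derivation "\<lambda>x p. d x p - bracket x (vfield A) p"
    by (rule d.minus_ad[OF vfield_in_W_X])
  have Euler: "(\<lambda>p. d (field1 (Var i) i) p - bracket (field1 (Var i) i) (vfield A) p) = (\<lambda>p. 0)" for i
  proof (rule W_X_eqI)
    fix j
    show "d (field1 (Var i) i) (Var j) - bracket (field1 (Var i) i) (vfield A) (Var j) = 0"
      using fun_cong[OF c, of i "Var j"] W_X_minus[OF field1_W_X, of "Var i" i "P j" "Const (c j)"]
      by (cases "i = j") (auto simp: bracket_def field1_Var vfield_Var A_def algebra_simps
          W_X_Const[OF field1_W_X] W_X_zero[OF vfield_in_W_X])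
  qed (auto intro!: W_X_diff W_X_0 bracket_in_W_X vfield_in_W_X field1_W_X d.into_W_X field1_W_inf)
  have "d x = bracket x (vfield A)" if "x \<in> W_inf" for x
    using A.vanish[OF kills[OF A] Euler that] by (auto simp: fun_eq_iff)
  moreover have "vfield A \<in> W_fin"
  proof -
    \<comment> \<open>The variable \<open>n\<close> occurs in \<open>A j\<close> exactly when
      \<open>pdiff n (A j)\<close>, the component \<open>j\<close> of \<open>d (field1 1 n)\<close>,
      is nonzero; that field lies in \<open>W_inf\<close>, so this happens for finitely many
      \<open>j\<close>.\<close>
    have "finite {j. n \<in> vars (A j)}" for n
    proof -
      obtain N where "\<And>j. j \<ge> N \<Longrightarrow> d (field1 1 n) (Var j) = 0"
        using W_inf_finite_support[OF W[OF field1_W_inf]] by metis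
      then have "{j. n \<in> vars (A j)} \<subseteq> {..<N}"
        using A pdiff_eq_0_iff by (metis (mono_tags, lifting) lessThan_iff linorder_not_less mem_Collect_eq subsetI)
      then show ?thesis using finite_subset by blast
    qed
    then show ?thesis using vfield_in_W_X by (auto simp: W_fin_def)
  qed
  ultimately show ?thesis by blast
qed

end
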